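(* The only pair of positive integers $(x,y)$ satisfying $$(x+y)^{x-y} = x^y$$ is $(x,y) = (1,1)$.
   Context: The exponent $x-y$ is an integer that may be zero or negative; powers are understood as rational numbers. *)

theory Defs
  imports Complex_Main
begin

end

(* If x > y, write x = d a and y = d b with a, b coprime. Taking d-th roots gives
   (d (a + b))^(a - b) = (d a)^b. Since a and a + b are coprime and a \<ge> 2, cancelling the
   common power of d leaves a nontrivial divisor on one side that is coprime to the other. *)
theory Submission
  imports Defs
begin

lemma power_sum_diff_neq:
  fixes x y :: nat
  assumes "y > 0" and "y < x"
  shows "(x + y) ^ (x - y) \<noteq> x ^ y"
proof
  assume eq: "(x + y) ^ (x - y) = x ^ y"
  define d where "d = gcd x y"
  have d: "d > 0" using assms by (simp add: d_def)
  obtain a b where x: "x = a * d" and y: "y = b * d" and cop: "coprime a b"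
    using gcd_coprime_exists[of x y] d unfolding d_def by auto
  have b: "b > 0" and ab: "b < a" using assms x y d by auto
  have "x - y = (a - b) * d" by (simp add: x y diff_mult_distrib)
  \<comment> \<open>Both exponents \<open>x - y\<close> and \<open>y\<close> are multiples of
    \<open>d\<close>; as \<open>d > 0\<close>, taking \<open>d\<close>-th powers is injective on
    naturals.\<close>
  with eq have "((x + y) ^ (a - b)) ^ d = (x ^ b) ^ d"
    by (simp add: y power_mult)
  with d have "(x + y) ^ (a - b) = x ^ b"
    by (simp add: power_eq_iff_eq_base)
  then have root: "(a + b) ^ (a - b) * d ^ (a - b) = a ^ b * d ^ b"
    by (simp add: x y power_mult_distrib flip: add_mult_distrib)
  have cop': "coprime (a + b) a" using cop by (simp add: coprime_iff_gcd_eq_1 gcd.commute[of _ a])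
  show False
  \<comment> \<open>The case split decides which side carries the smaller power of \<open>d\<close>,
    the one to be cancelled.\<close>
  proof (cases "b \<le> a - b")
    case True
    then have "d ^ (a - b) = d ^ (a - b - b) * d ^ b" by (simp flip: power_add)
    with root d have "(a + b) ^ (a - b) * d ^ (a - b - b) = a ^ b" by simp
    \<comment> \<open>The exponent \<open>a - b\<close> is positive, so a full factor
      \<open>a + b > 1\<close> survives on the left.\<close>
    then have "a + b dvd a ^ b"
      using ab dvd_mult2[OF dvd_power[of "a - b" "a + b"], of "d ^ (a - b - b)"] by simp
    moreover have "coprime (a + b) (a ^ b)" using cop' by simp
    ultimately have "is_unit (a + b)"
      using coprime_common_divisor[OF _ dvd_refl] by blast
    with b ab show False by simp
  next
    case False
    then have "d ^ b = d ^ (b - (a - b)) * d ^ (a - b)" by (simp flip: power_add)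
    with root d have "(a + b) ^ (a - b) = a ^ b * d ^ (b - (a - b))" by simp
    \<comment> \<open>Now the leftover power of \<open>d\<close> is on the right, and
      \<open>b > 0\<close> keeps a factor \<open>a\<close>, where \<open>a > b\<close> gives
      \<open>a \<ge> 2\<close>.\<close>
    then have "a dvd (a + b) ^ (a - b)"
      using b dvd_mult2[OF dvd_power[of b a], of "d ^ (b - (a - b))"] by simp
    moreover have "coprime a ((a + b) ^ (a - b))" using cop' by (simp add: coprime_commute)
    ultimately have "is_unit a"
      using coprime_common_divisor[OF _ dvd_refl] by blast
    with b ab show False by simp
  qed
qed

theorem mainTheorem12:
  fixes x y :: nat
  assumes "x > 0" and "y > 0"
  shows "(rat_of_nat (x + y)) powi (int x - int y) = rat_of_nat x ^ y \<longleftrightarrow> x = 1 \<and> y = 1"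
proof
  assume eq: "(rat_of_nat (x + y)) powi (int x - int y) = rat_of_nat x ^ y"
  consider "x < y" | "x = y" | "y < x" by linarith
  then show "x = 1 \<and> y = 1"
  proof cases
    \<comment> \<open>A negative exponent makes the left side the reciprocal of a number above 1,
      while the right side is at least 1.\<close>
    case 1
    then have "int x - int y = - int (y - x)" by simp
    with eq have "inverse (rat_of_nat (x + y) ^ (y - x)) = rat_of_nat x ^ y"
      by (simp only: power_int_minus power_int_of_nat)
    moreover have "1 < rat_of_nat (x + y) ^ (y - x)"
      using 1 assms by (intro one_less_power) linarith+
    then have "inverse (rat_of_nat (x + y) ^ (y - x)) < 1"
      by (rule inverse_less_1_iff[THEN iffD2, OF disjI2])
    moreover have "1 \<le> rat_of_nat x ^ y" using assms by (intro one_le_power) simp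
    ultimately show ?thesis by linarith
  next
    case 2
    \<comment> \<open>The exponent is zero, so the left side is 1.\<close>
    with eq have "rat_of_nat (x ^ x) = rat_of_nat 1" by simp
    then have "x ^ x = 1" by (simp only: of_nat_eq_iff)
    with assms 2 show ?thesis by simp
  next
    case 3
    then have "int x - int y = int (x - y)" by simp
    \<comment> \<open>With a positive exponent both sides are images of naturals, so the equation
      descends to \<open>nat\<close>.\<close>
    with eq have "rat_of_nat ((x + y) ^ (x - y)) = rat_of_nat (x ^ y)"
      by (simp only: power_int_of_nat of_nat_power)
    then have "(x + y) ^ (x - y) = x ^ y" by (simp only: of_nat_eq_iff)
    with power_sum_diff_neq[OF assms(2) 3] show ?thesis by simp
  qed
qed simp

end
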